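(* Let $x=\sum_{i=1}^{\infty}a_i\beta^{-i}$, where the sequence $(a_i)_{i\ge1}$ with $a_i\in\{0,1\}$ is generated by fair coin tosses, and $\beta=\frac{1+\sqrt5}{2}$ is the golden ratio. Then $\mathbb S_\beta(x)$ is an uncountably infinite set.
   Context: For $\beta\in(1,2)$ and $x\in[0,\frac1{\beta-1}]$, $\mathbb S_\beta(x)=\{(e_i)_{i\ge1}: e_i\in\{0,1\}\text{ for all } i \text{ and }\sum_{i=1}^\infty e_i\beta^{-i}=x\}$ is the set of expansions of $x$ in base $\beta$. A sequence generated by fair coin tosses is one whose terms are determined by independent tosses of a fair coin, with $1$ for heads and $0$ for tails. *)

theory Defs
  imports "HOL-Probability.Probability"
begin

text \<open>
  Sequences are indexed from 0: \<open>e i\<close> is the digit with weight \<open>\<beta>\<close> to the power \<open>-(i + 1)\<close>.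
\<close>

definition expansions :: "real \<Rightarrow> real \<Rightarrow> (nat \<Rightarrow> nat) set" where
  "expansions \<beta> x = {e. (\<forall>i. e i \<in> {0, 1}) \<and> (\<lambda>i. real (e i) / \<beta> ^ Suc i) sums x}"

definition fair_coin_sequence :: "'w measure \<Rightarrow> (nat \<Rightarrow> 'w \<Rightarrow> nat) \<Rightarrow> bool" where
  "fair_coin_sequence M a \<longleftrightarrow>
     prob_space M \<and>
     prob_space.indep_vars M (\<lambda>_. count_space UNIV) a UNIV \<and>
     (\<forall>i. \<forall>\<omega>\<in>space M. a i \<omega> \<in> {0, 1}) \<and>
     (\<forall>i. measure M {\<omega>\<in>space M. a i \<omega> = 1} = 1 / 2)"

end

theory Submission imports Defs begin

text \<open>
  For the golden ratio, \<open>1/\<beta> = 1/\<beta>\<^sup>2 + 1/\<beta>\<^sup>3\<close>, so replacing a block \<open>100\<close> of digits by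
  \<open>011\<close>, that is, complementing it, does not change the value. By independence, almost surely
  infinitely many of the blocks at positions \<open>3k, 3k + 1, 3k + 2\<close> are \<open>100\<close>, and any subset of
  them may be complemented. Distinct subsets give distinct expansions, and an infinite set of
  blocks has uncountably many subsets.
\<close>

text \<open>An infinite set contains an injective copy of \<open>nat\<close>, so its power set
  contains a copy of \<open>UNIV :: nat set set\<close>. Enumerating the latter by
  \<open>nat\<close> would contradict Cantor's theorem.\<close>

lemma uncountable_Pow:
  assumes "infinite S"
  shows "uncountable (Pow S)"
proof
  assume "countable (Pow S)"
  obtain g :: "nat \<Rightarrow> 'a" where g: "inj g" "range g \<subseteq> S"
    using assms infinite_countable_subset by blast
  have "inj (image g)"
    using inj_on_image_Pow[OF g(1)] by simp
  moreover have "range (image g) \<subseteq> Pow S" using g(2) by blast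
  ultimately have "countable (UNIV :: nat set set)"
    using \<open>countable (Pow S)\<close> countable_subset countable_image_inj_on by blast
  then have "range (from_nat_into (UNIV :: nat set set)) = UNIV"
    by (intro range_from_nat_into) auto
  then show False
    using Cantors_theorem[of "UNIV :: nat set"] by auto
qed

text \<open>The second Borel-Cantelli lemma for events of equal probability \<open>p\<close>: by
  independence, \<open>m + 1\<close> consecutive events all fail with probability
  \<open>(1 - p) ^ Suc m\<close>, which tends to 0. Hence for each \<open>n\<close> some event from
  \<open>n\<close> on occurs almost surely, and countably many null sets are discarded.\<close>

lemma (in prob_space) AE_infinite_if_indep_vars:
  fixes X :: "nat \<Rightarrow> 'a \<Rightarrow> bool"
  assumes indep: "indep_vars (\<lambda>_. count_space UNIV) X UNIV"
    and prob: "\<And>k. prob {\<omega> \<in> space M. X k \<omega>} = p" and "p > 0"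
  shows "AE \<omega> in M. infinite {k. X k \<omega>}"
proof -
  have [measurable]: "X k \<in> measurable M (count_space UNIV)" for k
    using indep by (simp add: indep_vars_def2)
  have "AE \<omega> in M. \<exists>k\<ge>n. X k \<omega>" for n
  proof -
    let ?N = "{\<omega> \<in> space M. \<forall>k\<ge>n. \<not> X k \<omega>}"
    have miss: "prob (X k -` {False} \<inter> space M) = 1 - p" for k
    proof -
      have "X k -` {False} \<inter> space M = space M - {\<omega> \<in> space M. X k \<omega>}" by auto
      then show ?thesis using prob[of k] by (simp add: prob_compl)
    qed
    have "prob ?N \<le> (1 - p) ^ Suc m" for m
    proof -
      have "prob ?N \<le> prob (\<Inter>k\<in>{n..n+m}. X k -` {False} \<inter> space M)"
      proof (rule finite_measure_mono)
        show "(\<Inter>k\<in>{n..n+m}. X k -` {False} \<inter> space M) \<in> events"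
          by (intro sets.finite_INT) simp_all
      qed force
      also have "\<dots> = (\<Prod>k\<in>{n..n+m}. prob (X k -` {False} \<inter> space M))"
        by (rule indep_varsD[OF indep]) auto
      also have "\<dots> = (1 - p) ^ Suc m" by (simp add: miss)
      finally show ?thesis .
    qed
    moreover have "(\<lambda>m. (1 - p) ^ Suc m) \<longlonglongrightarrow> 0"
    proof (rule LIMSEQ_Suc, rule LIMSEQ_realpow_zero)
      show "0 \<le> 1 - p" using prob[of 0] prob_le_1[of "{\<omega> \<in> space M. X 0 \<omega>}"] by simp
    qed (use \<open>p > 0\<close> in simp)
    ultimately have "prob ?N \<le> 0"
      by (intro LIMSEQ_le_const[of _ 0]) auto
    then have "prob ?N = 0" by (simp add: measure_le_0_iff)
    then have "AE \<omega> in M. \<omega> \<notin> ?N" by (subst (asm) prob_eq_0) simp_all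
    then show ?thesis by (rule AE_mp) (auto intro!: AE_I2)
  qed
  then have "AE \<omega> in M. \<forall>n. \<exists>k\<ge>n. X k \<omega>"
    by (simp add: AE_all_countable)
  then show ?thesis
    by (auto simp: infinite_nat_iff_unbounded_le)
qed

text \<open>Only occurrences of the word \<open>w\<close> at multiples of \<open>L\<close> are
  considered: these involve disjoint sets of tosses, so they are independent, each of probability
  \<open>(1 / 2) ^ L\<close>.\<close>

lemma fair_coin_sequence_AE_infinite_blocks:
  fixes w :: "nat \<Rightarrow> nat"
  assumes "fair_coin_sequence M a" and w: "\<And>i. w i \<in> {0, 1}" and "L > 0"
  shows "AE \<omega> in M. infinite {k. \<forall>i<L. a (k * L + i) \<omega> = w i}"
proof -
  interpret prob_space M using assms by (simp add: fair_coin_sequence_def)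
  have indep: "indep_vars (\<lambda>_. count_space UNIV) a UNIV"
    and a01: "\<And>i \<omega>. \<omega> \<in> space M \<Longrightarrow> a i \<omega> \<in> {0, 1}"
    and half: "\<And>i. prob {\<omega> \<in> space M. a i \<omega> = 1} = 1 / 2"
    using assms by (auto simp: fair_coin_sequence_def)
  have [measurable]: "a i \<in> measurable M (count_space UNIV)" for i
    using indep by (simp add: indep_vars_def2)
  have prob_digit: "prob (a i -` {d} \<inter> space M) = 1 / 2" if "d \<in> {0, 1}" for i d
  proof (cases "d = 1")
    case True
    then show ?thesis using half[of i] by (simp add: vimage_def Int_def conj_commute)
  next
    case False
    then have "a i -` {d} \<inter> space M = space M - {\<omega> \<in> space M. a i \<omega> = 1}"
      using a01 that by fastforce
    then show ?thesis using half[of i] by (simp add: prob_compl)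
  qed
  define J where "J k = {k * L..<k * L + L}" for k
  have "disjoint_family J"
  proof (unfold disjoint_family_on_def, intro ballI impI)
    fix k l :: nat
    assume "k \<noteq> l"
    have "j div L = k" if "j \<in> J k" for j k
      using that unfolding J_def
      by (intro div_nat_eqI) (auto simp: algebra_simps)
    then show "J k \<inter> J l = {}" using \<open>k \<noteq> l\<close> by auto
  qed
  then have "indep_vars (\<lambda>k. PiM (J k) (\<lambda>_. count_space UNIV))
      (\<lambda>k \<omega>. restrict (\<lambda>i. a i \<omega>) (J k)) UNIV"
    by (intro indep_vars_restrict[OF indep]) auto
  \<comment> \<open>Whether block \<open>k\<close> spells \<open>w\<close> is a measurable function
    of the tuple of digits on \<open>J k\<close>, so independence passes from the tuples to these
    truth values.\<close>
  then have "indep_vars (\<lambda>_. count_space UNIV)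
      (\<lambda>k \<omega>. \<forall>i\<in>{..<L}. restrict (\<lambda>i. a i \<omega>) (J k) (k * L + i) = w i) UNIV"
  proof (rule indep_vars_compose2[where Y = "\<lambda>k f. \<forall>i\<in>{..<L}. f (k * L + i) = w i"])
    fix k
    have [measurable]: "(\<lambda>f. f (k * L + i)) \<in>
        measurable (PiM (J k) (\<lambda>_. count_space UNIV)) (count_space UNIV)" if "i \<in> {..<L}" for i
      using that by (intro measurable_component_singleton) (auto simp: J_def)
    show "(\<lambda>f. \<forall>i\<in>{..<L}. f (k * L + i) = w i) \<in>
        measurable (PiM (J k) (\<lambda>_. count_space UNIV)) (count_space UNIV)"
      by measurable
  qed
  then have "indep_vars (\<lambda>_. count_space UNIV) (\<lambda>k \<omega>. \<forall>i<L. a (k * L + i) \<omega> = w i) UNIV"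
    unfolding Ball_def lessThan_iff by (simp add: J_def cong: imp_cong)
  moreover have "prob {\<omega> \<in> space M. \<forall>i<L. a (k * L + i) \<omega> = w i} = (1 / 2) ^ L" for k
  proof -
    \<comment> \<open>Reindexing by the absolute position \<open>j = k * L + i\<close> gives an
      intersection over the nonempty finite set \<open>J k\<close>, to which the product rule
      applies.\<close>
    have "{\<omega> \<in> space M. \<forall>i<L. a (k * L + i) \<omega> = w i} =
        (\<Inter>j\<in>J k. a j -` {w (j - k * L)} \<inter> space M)"
      using \<open>L > 0\<close> by (auto simp: J_def) (metis add_diff_inverse_nat add_less_cancel_left leD)
    also have "prob \<dots> = (\<Prod>j\<in>J k. prob (a j -` {w (j - k * L)} \<inter> space M))"
      using \<open>L > 0\<close> by (intro indep_varsD[OF indep]) (auto simp: J_def)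
    also have "\<dots> = (1 / 2) ^ L"
      by (simp only: prob_digit[OF w]) (simp add: J_def)
    finally show ?thesis .
  qed
  ultimately show ?thesis
    by (rule AE_infinite_if_indep_vars) simp
qed

lemma summable_expansion:
  fixes \<beta> :: real
  assumes "\<beta> > 1" and "\<And>i. e i \<in> {0, 1 :: nat}"
  shows "summable (\<lambda>i. real (e i) / \<beta> ^ Suc i)"
proof (rule summable_comparison_test[OF _ summable_geometric])
  show "\<exists>N. \<forall>i\<ge>N. norm (real (e i) / \<beta> ^ Suc i) \<le> (1 / \<beta>) ^ i"
  proof (intro exI allI impI)
    fix i
    have "real (e i) \<le> 1" using assms(2)[of i] by auto
    moreover have "\<beta> ^ i \<le> \<beta> ^ Suc i" using \<open>\<beta> > 1\<close> by simp
    ultimately show "norm (real (e i) / \<beta> ^ Suc i) \<le> (1 / \<beta>) ^ i"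
      using \<open>\<beta> > 1\<close> by (simp add: power_one_over frac_le del: power_Suc)
  qed
qed (use \<open>\<beta> > 1\<close> in auto)

text \<open>\<open>T\<close> contains block numbers, not positions. On digits 0 and 1, the natural
  number difference \<open>1 - e i\<close> is the complement.\<close>

definition flip_blocks :: "(nat \<Rightarrow> nat) \<Rightarrow> nat set \<Rightarrow> nat \<Rightarrow> nat" where
  "flip_blocks e T i = (if i div 3 \<in> T then 1 - e i else e i)"

lemma flip_blocks_in_expansions:
  fixes \<beta> :: real
  assumes "\<beta> > 1" and golden: "\<beta>\<^sup>2 = \<beta> + 1" and e01: "\<And>i. e i \<in> {0, 1}"
    and T: "\<And>k. k \<in> T \<Longrightarrow> e (k * 3) = 1 \<and> e (k * 3 + 1) = 0 \<and> e (k * 3 + 2) = 0"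
  shows "flip_blocks e T \<in> expansions \<beta> (\<Sum>i. real (e i) / \<beta> ^ Suc i)"
proof -
  let ?f = "\<lambda>e i. real (e i) / \<beta> ^ Suc i"
  have flip01: "flip_blocks e T i \<in> {0, 1}" for i
    using e01[of i] by (auto simp: flip_blocks_def)
  have "sum (?f (flip_blocks e T)) {k * 3..<k * 3 + 3} = sum (?f e) {k * 3..<k * 3 + 3}" for k
  proof -
    have block: "{k * 3..<k * 3 + 3} = {k * 3, k * 3 + 1, k * 3 + 2}" by auto
    have div_block: "Suc (k * 3) div 3 = k" "Suc (Suc (k * 3)) div 3 = k" by arith+
    \<comment> \<open>The golden ratio identity divided by \<open>\<beta> ^ (k * 3 + 3)\<close>: the
      weights of the last two digits of a block add up to that of the first.\<close>
    have "1 / \<beta> ^ Suc (k * 3 + 1) + 1 / \<beta> ^ Suc (k * 3 + 2) = 1 / \<beta> ^ Suc (k * 3)"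
    proof -
      have "1 / \<beta> ^ Suc (k * 3 + 1) + 1 / \<beta> ^ Suc (k * 3 + 2) = (\<beta> + 1) / \<beta> ^ Suc (k * 3 + 2)"
        using \<open>\<beta> > 1\<close> by (simp add: field_simps)
      also have "\<dots> = \<beta>\<^sup>2 / (\<beta>\<^sup>2 * \<beta> ^ Suc (k * 3))"
        by (simp add: golden[symmetric] power2_eq_square mult_ac)
      finally show ?thesis using \<open>\<beta> > 1\<close> by simp
    qed
    then show ?thesis
      using T[of k] by (cases "k \<in> T") (simp_all add: block flip_blocks_def div_block)
  qed
  moreover have "summable (?f e)" "summable (?f (flip_blocks e T))"
    using summable_expansion[OF \<open>\<beta> > 1\<close> e01] summable_expansion[OF \<open>\<beta> > 1\<close> flip01] .
  \<comment> \<open>Convergence of both series allows grouping their terms in threes. The grouped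
    series coincide term by term, so uniqueness of the sum identifies the two values.\<close>
  ultimately have "(\<lambda>k. sum (?f e) {k * 3..<k * 3 + 3}) sums (\<Sum>i. ?f e i)"
    and "(\<lambda>k. sum (?f e) {k * 3..<k * 3 + 3}) sums (\<Sum>i. ?f (flip_blocks e T) i)"
    using sums_group[of "?f e" "suminf (?f e)" 3]
      sums_group[of "?f (flip_blocks e T)" "suminf (?f (flip_blocks e T))" 3]
    by (simp_all only: summable_sums zero_less_numeral simp_thms)
  then have "(\<Sum>i. ?f e i) = (\<Sum>i. ?f (flip_blocks e T) i)"
    by (rule sums_unique2)
  then have "?f (flip_blocks e T) sums (\<Sum>i. ?f e i)"
    using summable_sums[OF \<open>summable (?f (flip_blocks e T))\<close>] by (simp only:)
  then show ?thesis
    unfolding expansions_def using flip01 by blast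
qed

text \<open>The set \<open>T\<close> can be recovered from the first digit of each block, since a
  digit 0 or 1 always differs from its complement.\<close>

lemma inj_flip_blocks:
  assumes "\<And>i. e i \<in> {0, 1}"
  shows "inj (flip_blocks e)"
proof (rule injI)
  fix S T
  assume "flip_blocks e S = flip_blocks e T"
  moreover have "k \<in> T \<longleftrightarrow> flip_blocks e T (k * 3) \<noteq> e (k * 3)" for k T
    using assms[of "k * 3"] by (auto simp: flip_blocks_def)
  ultimately show "S = T" by (metis subsetI subset_antisym)
qed

theorem lemma3p2:
  fixes M :: "'w measure" and a :: "nat \<Rightarrow> 'w \<Rightarrow> nat" and \<beta> :: real
  assumes "\<beta> = (1 + sqrt 5) / 2"
    and "fair_coin_sequence M a"
  shows "AE \<omega> in M. uncountable (expansions \<beta> (\<Sum>i. real (a i \<omega>) / \<beta> ^ Suc i))"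
proof -
  have "\<beta> > 1" unfolding assms(1) by (simp add: less_divide_eq)
  have golden: "\<beta>\<^sup>2 = \<beta> + 1"
    by (simp add: assms(1) power2_eq_square field_simps)
  \<comment> \<open>The conditional expression encodes the word 100.\<close>
  have "AE \<omega> in M. infinite {k. \<forall>i<3. a (k * 3 + i) \<omega> = (if i = 0 then 1 else 0)}"
    by (rule fair_coin_sequence_AE_infinite_blocks[OF assms(2)]) auto
  then show ?thesis
  proof (rule AE_mp, intro AE_I2 impI)
    fix \<omega>
    let ?S = "{k. \<forall>i<3. a (k * 3 + i) \<omega> = (if i = 0 then 1 else 0)}"
    let ?e = "\<lambda>i. a i \<omega>"
    assume \<omega>: "\<omega> \<in> space M" "infinite ?S"
    then have e01: "?e i \<in> {0, 1}" for i
      using assms(2) by (simp add: fair_coin_sequence_def)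
    have "flip_blocks ?e ` Pow ?S \<subseteq> expansions \<beta> (\<Sum>i. real (a i \<omega>) / \<beta> ^ Suc i)"
    proof (intro image_subsetI flip_blocks_in_expansions[OF \<open>\<beta> > 1\<close> golden e01])
      fix T k
      assume "T \<in> Pow ?S" "k \<in> T"
      then have *: "a (k * 3 + i) \<omega> = (if i = 0 then 1 else 0)" if "i < 3" for i
        using that by blast
      show "a (k * 3) \<omega> = 1 \<and> a (k * 3 + 1) \<omega> = 0 \<and> a (k * 3 + 2) \<omega> = 0"
        using *[of 0] *[of 1] *[of 2] by simp
    qed
    moreover have "inj_on (flip_blocks ?e) (Pow ?S)"
      by (rule inj_on_subset[OF inj_flip_blocks[OF e01] subset_UNIV])
    then have "uncountable (flip_blocks ?e ` Pow ?S)"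
      by (rule contrapos_nn[OF uncountable_Pow[OF \<omega>(2)] countable_image_inj_on[rotated]])
    ultimately show "uncountable (expansions \<beta> (\<Sum>i. real (a i \<omega>) / \<beta> ^ Suc i))"
      by (meson countable_subset)
  qed
qed

end
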